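(* Let $\Gamma$ be a finitely generated infinite group, $K$ a symmetric finite generating subset of $\Gamma$, $m$ a symmetric weight on $K$, $1<p<\infty$, and $q=p/(p-1)$ the conjugate exponent of $p$. Let $\lambda_{\Gamma,p}$ be the left regular representation of $\Gamma$ on $\ell^p(\Gamma)$. Then the following are equivalent. (i) There is a constant $C'>0$ such that every $f\in\ell^p(\Gamma)$ satisfies $\max_{\gamma\in K}\|\lambda_{\Gamma,p}(\gamma)f-f\|_{\ell^p(\Gamma)}\ge C'\|f\|_{\ell^p(\Gamma)}$. (ii) There is a constant $C>0$ such that every $f\in\ell^p(\Gamma)$ satisfies $\|\Delta_pf\|_{\ell^q(\Gamma)}\ge C\|f\|_{D_p(\Gamma)}^{p-1}$.
   Context: Functions are complex-valued. $K$ symmetric means $K^{-1}=K$; a symmetric weight on $K$ is a function $m:K\to(0,\infty)$ with $\sum_{\gamma\in K}m(\gamma)=1$ and $m(\gamma)=m(\gamma^{-1})$. For $f:\Gamma\to\mathbb{C}$ put $(\lambda_\Gamma(\gamma)f)(\gamma')=f(\gamma^{-1}\gamma')$ and $df(\gamma)=\lambda_\Gamma(\gamma)f-f$ (a function on $\Gamma$); $\lambda_{\Gamma,p}$ is the restriction of $\lambda_\Gamma$ to $\ell^p(\Gamma)$, with norm $\|f\|_{\ell^p(\Gamma)}=(\sum_{\gamma\in\Gamma}|f(\gamma)|^p)^{1/p}$. The space of $p$-Dirichlet finite functions is $D_p(\Gamma)=\{f:\Gamma\to\mathbb{C} : df(\gamma)\in\ell^p(\Gamma)\text{ for all }\gamma\in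 K\}\supset\ell^p(\Gamma)$, and for $f\in D_p(\Gamma)$, $$\|f\|_{D_p(\Gamma)}=\Big(\sum_{\gamma\in K}\|df(\gamma)\|_{\ell^p(\Gamma)}^p\,m(\gamma)\Big)^{1/p}$$ (a norm modulo constant functions). The $p$-Laplacian of $f\in D_p(\Gamma)$ is $$\Delta_pf(x)=\sum_{\gamma\in K}|df(\gamma)(x)|^{p-2}\,df(\gamma)(x)\,m(\gamma)\quad(x\in\Gamma),$$ where for $p<2$ one sets $|df(\gamma)(x)|^{p-2}=0$ whenever $df(\gamma)(x)=0$. *)

theory Defs
  imports "HOL-Analysis.Analysis" "HOL-Algebra.Generated_Groups"
begin

text \<open>
  Functions on the group are total functions \<open>'a \<Rightarrow> complex\<close>. Every notion below depends only
  on their values on \<open>carrier G\<close>, so values outside the carrier are irrelevant.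
\<close>

definition symmetric_set :: "('a, 'b) monoid_scheme \<Rightarrow> 'a set \<Rightarrow> bool" where
  "symmetric_set G K \<longleftrightarrow> (\<lambda>\<gamma>. inv\<^bsub>G\<^esub> \<gamma>) ` K = K"

definition symmetric_weight :: "('a, 'b) monoid_scheme \<Rightarrow> 'a set \<Rightarrow> ('a \<Rightarrow> real) \<Rightarrow> bool" where
  "symmetric_weight G K m \<longleftrightarrow>
     (\<forall>\<gamma>\<in>K. m \<gamma> > 0) \<and> (\<Sum>\<gamma>\<in>K. m \<gamma>) = 1 \<and> (\<forall>\<gamma>\<in>K. m \<gamma> = m (inv\<^bsub>G\<^esub> \<gamma>))"

definition ell :: "real \<Rightarrow> ('a, 'b) monoid_scheme \<Rightarrow> ('a \<Rightarrow> complex) set" where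
  "ell p G = {f. (\<lambda>x. cmod (f x) powr p) summable_on carrier G}"

text \<open>
  The norm is meaningful only on \<open>ell p G\<close>, since \<open>infsum\<close> is \<open>0\<close> on non-summable families.
\<close>

definition ell_norm :: "real \<Rightarrow> ('a, 'b) monoid_scheme \<Rightarrow> ('a \<Rightarrow> complex) \<Rightarrow> real" where
  "ell_norm p G f = (\<Sum>\<^sub>\<infinity>x\<in>carrier G. cmod (f x) powr p) powr (1 / p)"

definition left_regular ::
  "('a, 'b) monoid_scheme \<Rightarrow> 'a \<Rightarrow> ('a \<Rightarrow> complex) \<Rightarrow> 'a \<Rightarrow> complex" where
  "left_regular G \<gamma> f = (\<lambda>x. f (inv\<^bsub>G\<^esub> \<gamma> \<otimes>\<^bsub>G\<^esub> x))"

definition grad :: "('a, 'b) monoid_scheme \<Rightarrow> ('a \<Rightarrow> complex) \<Rightarrow> 'a \<Rightarrow> 'a \<Rightarrow> complex" where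
  "grad G f \<gamma> = left_regular G \<gamma> f - f"

definition dirichlet_space ::
  "real \<Rightarrow> ('a, 'b) monoid_scheme \<Rightarrow> 'a set \<Rightarrow> ('a \<Rightarrow> complex) set" where
  "dirichlet_space p G K = {f. \<forall>\<gamma>\<in>K. grad G f \<gamma> \<in> ell p G}"

text \<open>
  The following two notions are meant for \<open>f \<in> dirichlet_space p G K\<close>, which contains \<open>ell p G\<close>
  (the latter being translation invariant and a vector space). For such \<open>f\<close> the \<open>p\<close>-Laplacian
  lies in \<open>ell q G\<close> with \<open>q = p / (p - 1)\<close>, because each \<open>grad G f \<gamma>\<close> is in \<open>ell p G\<close> and
  \<open>(p - 1) * q = p\<close>; so all norms involved are genuine, finite norms.
\<close>

definition dirichlet_norm ::
  "real \<Rightarrow> ('a, 'b) monoid_scheme \<Rightarrow> 'a set \<Rightarrow> ('a \<Rightarrow> real) \<Rightarrow> ('a \<Rightarrow> complex) \<Rightarrow> real" where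
  "dirichlet_norm p G K m f = (\<Sum>\<gamma>\<in>K. ell_norm p G (grad G f \<gamma>) powr p * m \<gamma>) powr (1 / p)"

text \<open>
  As \<open>0 powr a = 0\<close> for every \<open>a\<close>, the convention for vanishing differences when \<open>p < 2\<close> is built
  in; for \<open>p \<ge> 2\<close> such terms vanish in any case because of the factor \<open>grad G f \<gamma> x\<close>.
\<close>

definition p_laplacian ::
  "real \<Rightarrow> ('a, 'b) monoid_scheme \<Rightarrow> 'a set \<Rightarrow> ('a \<Rightarrow> real) \<Rightarrow> ('a \<Rightarrow> complex) \<Rightarrow> 'a \<Rightarrow> complex" where
  "p_laplacian p G K m f x =
     (\<Sum>\<gamma>\<in>K. of_real (cmod (grad G f \<gamma> x) powr (p - 2)) * grad G f \<gamma> x * of_real (m \<gamma>))"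

end

theory Submission
  imports Defs
begin

text \<open>
  (i) implies (ii): summation by parts gives $2 \langle \Delta_p f, f\rangle = -\|f\|_{D_p}^p$;
  apply Young's inequality and absorb $\|f\|_p$ by means of (i).

  (ii) implies (i): if $\|f_0\|_{D_p} < a$ is small compared with $b = \|f_0\|_p$, let $f$ minimise
  $g \mapsto \|g\|_{D_p} + \kappa \|g - f_0\|_p^p$ with $\kappa = 4^p a / b^p$. Then
  $\|f - f_0\|_p \le b/4$, so $f \ne 0$, and the Euler--Lagrange equation
  $2 \|f\|_{D_p}^{1-p} \Delta_p f = \kappa p |f - f_0|^{p-2} (f - f_0)$ shows that
  $\|\Delta_p f\|_q = (\kappa p/2) \|f\|_{D_p}^{p-1} \|f - f_0\|_p^{p-1}
  \le 2 p (a/b) \|f\|_{D_p}^{p-1}$, which bounds $a/b$ from below. Using the norm rather than its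
  $p$-th power in the functional is what produces the factor $\|f\|_{D_p}^{p-1}$.
\<close>

subsection \<open>The spaces $\ell^p$ and the duality map\<close>

text \<open>Bounding the sum by twice the larger modulus is cruder than convexity, but closure of
  \<open>ell p G\<close> under addition only asks for finiteness.\<close>

lemma powr_cmod_add_le:
  assumes "0 \<le> p"
  shows "cmod (a + b) powr p \<le> 2 powr p * (cmod a powr p + cmod b powr p)"
proof -
  have "cmod (a + b) powr p \<le> (2 * max (cmod a) (cmod b)) powr p"
    using norm_triangle_ineq[of a b] by (intro powr_mono2 assms) auto
  also have "\<dots> = 2 powr p * max (cmod a) (cmod b) powr p"
    by (simp add: powr_mult)
  also have "\<dots> \<le> 2 powr p * (cmod a powr p + cmod b powr p)"
    by (intro mult_left_mono) (auto simp: max_def)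
  finally show ?thesis .
qed

lemma ell_add:
  assumes "0 \<le> p" "f \<in> ell p G" "g \<in> ell p G"
  shows "(\<lambda>x. f x + g x) \<in> ell p G"
  unfolding ell_def mem_Collect_eq
proof (rule summable_on_comparison_test)
  show "(\<lambda>x. 2 powr p * (cmod (f x) powr p + cmod (g x) powr p)) summable_on carrier G"
    using assms unfolding ell_def by (intro summable_on_cmult_right summable_on_add) auto
qed (use powr_cmod_add_le[OF assms(1)] in auto)

lemma ell_uminus: "f \<in> ell p G \<Longrightarrow> (\<lambda>x. - f x) \<in> ell p G"
  by (simp add: ell_def)

lemma ell_diff:
  assumes "0 \<le> p" "f \<in> ell p G" "g \<in> ell p G"
  shows "f - g \<in> ell p G"
  using ell_add[OF assms(1,2) ell_uminus[OF assms(3)]] by (simp add: fun_diff_def)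

lemma ell_norm_powr:
  assumes "0 < p"
  shows "ell_norm p G f powr p = (\<Sum>\<^sub>\<infinity>x\<in>carrier G. cmod (f x) powr p)"
  using assms by (simp add: ell_norm_def powr_powr infsum_nonneg)

lemma (in group) bij_betw_left_mult:
  assumes "g \<in> carrier G"
  shows "bij_betw (\<lambda>x. g \<otimes> x) (carrier G) (carrier G)"
  by (rule bij_betw_byWitness[where f' = "\<lambda>x. inv g \<otimes> x"])
    (use assms in \<open>auto simp: m_assoc[symmetric]\<close>)

lemma (in group) ell_left_regular:
  assumes "g \<in> carrier G" "f \<in> ell p G"
  shows "left_regular G g f \<in> ell p G"
  using summable_on_reindex_bij_betw[OF bij_betw_left_mult[of "inv g"],
      of "\<lambda>x. cmod (f x) powr p"] assms
  by (simp add: ell_def left_regular_def)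

lemma (in group) ell_grad:
  assumes "0 \<le> p" "g \<in> carrier G" "f \<in> ell p G"
  shows "grad G f g \<in> ell p G"
  unfolding grad_def by (intro ell_diff ell_left_regular assms)

definition duality_map :: "real \<Rightarrow> complex \<Rightarrow> complex" where
  "duality_map p z = of_real (cmod z powr (p - 2)) * z"

lemma duality_map_minus: "duality_map p (- z) = - duality_map p z"
  by (simp add: duality_map_def)

lemma duality_map_0 [simp]: "duality_map p 0 = 0"
  by (simp add: duality_map_def)

lemma norm_duality_map:
  shows "cmod (duality_map p z) = cmod z powr (p - 1)"
proof (cases "z = 0")
  case False
  then have "cmod z powr (p - 2) * cmod z = cmod z powr (p - 2) * cmod z powr 1"
    by simp
  also have "\<dots> = cmod z powr (p - 1)" unfolding powr_add[symmetric] by simp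
  finally show ?thesis by (simp add: duality_map_def norm_mult)
qed (simp add: duality_map_def)

lemma duality_map_mult_cnj: "duality_map p z * cnj z = of_real (cmod z powr p)"
proof (cases "z = 0")
  case False
  then have "cmod z powr (p - 2) * (cmod z)\<^sup>2 = cmod z powr p"
    by (simp flip: powr_numeral add: powr_add[symmetric])
  then show ?thesis
    by (simp add: duality_map_def mult.assoc flip: complex_norm_square of_real_mult of_real_power)
qed (simp add: duality_map_def)

section \<open>Differentiating p-th powers of moduli\<close>

text \<open>Away from a = 0 the function is the power p/2 of a quadratic polynomial in t that is
  positive at t = 0. At a = 0 the difference quotient has modulus $|h|^{p-1} |b|^p$, which tends to
  0 because p > 1.\<close>

lemma DERIV_cmod_powr:
  assumes "1 < p"
  shows "((\<lambda>t::real. cmod (a + of_real t * b) powr p) has_real_derivative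
           p * Re (duality_map p a * cnj b)) (at 0)"
proof (cases "a = 0")
  case True
  have "((\<lambda>h. (cmod (a + of_real h * b) powr p - cmod (a + of_real 0 * b) powr p) / h) \<longlongrightarrow> 0) (at 0)"
  proof (rule Lim_null_comparison)
    show "\<forall>\<^sub>F h in at 0. norm ((cmod (a + of_real h * b) powr p - cmod (a + of_real 0 * b) powr p) / h)
            \<le> \<bar>h\<bar> powr (p - 1) * cmod b powr p"
    proof (intro eventuallyI)
      fix h :: real
      have "\<bar>h\<bar> powr p / \<bar>h\<bar> = \<bar>h\<bar> powr (p - 1)"
        by (cases "h = 0") (auto simp: powr_diff)
      moreover have "norm ((cmod (a + of_real h * b) powr p - cmod (a + of_real 0 * b) powr p) / h) =
          \<bar>h\<bar> powr p / \<bar>h\<bar> * cmod b powr p"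
        using assms True by (simp add: norm_mult powr_mult abs_mult)
      ultimately show "norm ((cmod (a + of_real h * b) powr p - cmod (a + of_real 0 * b) powr p) / h)
            \<le> \<bar>h\<bar> powr (p - 1) * cmod b powr p"
        by simp
    qed
    have "((\<lambda>h::real. \<bar>h\<bar> powr (p - 1)) \<longlongrightarrow> \<bar>0\<bar> powr (p - 1)) (at 0)"
      by (rule tendsto_powr') (use assms in \<open>auto intro!: tendsto_rabs_zero\<close>)
    then show "((\<lambda>h. \<bar>h\<bar> powr (p - 1) * cmod b powr p) \<longlongrightarrow> 0) (at 0)"
      by (auto intro: tendsto_mult_left_zero)
  qed
  then show ?thesis
    using True by (simp add: DERIV_def)
next
  case False
  define s where "s = (\<lambda>t. (Re a + t * Re b)\<^sup>2 + (Im a + t * Im b)\<^sup>2)"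
  have s: "s t = (cmod (a + of_real t * b))\<^sup>2" for t
    by (simp add: s_def cmod_power2)
  have "cmod (a + of_real t * b) powr p = s t powr (p / 2)" for t
    unfolding s by (cases "a + of_real t * b = 0") (simp_all flip: powr_numeral add: powr_powr)
  moreover have s0: "s 0 > 0" using False by (simp add: s)
  moreover have "(s has_real_derivative 2 * Re (a * cnj b)) (at 0)"
    unfolding s_def by (auto intro!: derivative_eq_intros)
  \<comment> \<open>The rule also allows the exponent to vary; here it is constant, which leaves the
    vanishing term \<open>0 * ln (s 0)\<close>.\<close>
  then have "((\<lambda>t. s t powr (p / 2)) has_real_derivative
      s 0 powr (p / 2) * (0 * ln (s 0) + 2 * Re (a * cnj b) * (p / 2) / s 0)) (at 0)"
    by (rule DERIV_powr) (auto intro!: derivative_eq_intros s0)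
  moreover have "s 0 powr (p / 2) * (0 * ln (s 0) + 2 * Re (a * cnj b) * (p / 2) / s 0) =
      p * Re (duality_map p a * cnj b)"
  proof -
    have "s 0 powr (p / 2) / s 0 = cmod a powr (p - 2)"
      using False by (simp add: s powr_diff flip: powr_numeral add: powr_powr)
    moreover have "s 0 powr (p / 2) * (0 * ln (s 0) + 2 * Re (a * cnj b) * (p / 2) / s 0) =
        p * (s 0 powr (p / 2) / s 0 * Re (a * cnj b))"
      using s0 by (simp add: field_simps)
    moreover have "Re (duality_map p a * cnj b) = cmod a powr (p - 2) * Re (a * cnj b)"
      by (simp add: duality_map_def distrib_left mult.assoc right_diff_distrib)
    ultimately show ?thesis by simp
  qed
  ultimately show ?thesis by simp
qed

lemma has_sum_finite_sum:
  fixes f :: "'i \<Rightarrow> 'a \<Rightarrow> 'b::topological_comm_monoid_add"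
  assumes "finite I" "\<And>i. i \<in> I \<Longrightarrow> (f i has_sum s i) A"
  shows "((\<lambda>x. \<Sum>i\<in>I. f i x) has_sum (\<Sum>i\<in>I. s i)) A"
  using assms by (induction I) (simp_all add: has_sum_add)

lemma grad_apply: "grad G f \<gamma> x = f (inv\<^bsub>G\<^esub> \<gamma> \<otimes>\<^bsub>G\<^esub> x) - f x"
  by (simp add: grad_def left_regular_def)

lemma p_laplacian_eq:
  "p_laplacian p G K m f x = (\<Sum>\<gamma>\<in>K. of_real (m \<gamma>) * duality_map p (grad G f \<gamma> x))"
  by (simp add: p_laplacian_def duality_map_def mult_ac)

lemma ell_cmult:
  assumes "f \<in> ell p G"
  shows "(\<lambda>x. c * f x) \<in> ell p G"
  using assms by (auto simp: ell_def norm_mult powr_mult intro: summable_on_cmult_right)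

lemma ell_zero: "(\<lambda>x. 0) \<in> ell p G"
  by (simp add: ell_def)

lemma ell_sum:
  assumes "0 \<le> p" "finite I" "\<And>i. i \<in> I \<Longrightarrow> f i \<in> ell p G"
  shows "(\<lambda>x. \<Sum>i\<in>I. f i x) \<in> ell p G"
  using assms(2,3) by (induction I) (simp_all add: ell_zero ell_add[OF assms(1)])

lemma norm_duality_map_powr:
  assumes "1 < p" "q = p / (p - 1)"
  shows "cmod (duality_map p z) powr q = cmod z powr p"
  using assms by (simp add: norm_duality_map powr_powr)

lemma duality_map_ell:
  assumes "1 < p" "q = p / (p - 1)" "f \<in> ell p G"
  shows "(\<lambda>x. duality_map p (f x)) \<in> ell q G"
  using assms by (simp add: ell_def norm_duality_map_powr)

lemma ell_mult_abs_summable: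
  assumes "1 < p" "1 < q" "1 / p + 1 / q = 1" "u \<in> ell p G" "v \<in> ell q G"
  shows "(\<lambda>x. cmod (u x) * cmod (v x)) summable_on carrier G"
proof (rule summable_on_comparison_test)
  show "(\<lambda>x. cmod (u x) powr p * (1 / p) + cmod (v x) powr q * (1 / q)) summable_on carrier G"
    using assms(4,5) unfolding ell_def mem_Collect_eq
    by (intro summable_on_add summable_on_cmult_left)
qed (use Youngs_inequality[OF assms(1-3)] in auto)

lemma ell_mult_cnj_summable:
  assumes "1 < p" "1 < q" "1 / p + 1 / q = 1" "u \<in> ell p G" "v \<in> ell q G"
  shows "(\<lambda>x. v x * cnj (u x)) summable_on carrier G"
  by (rule abs_summable_summable)
    (use ell_mult_abs_summable[OF assms] in \<open>simp add: norm_mult mult.commute\<close>)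

lemma summable_on_bounded_sums:
  fixes h :: "'a \<Rightarrow> real"
  assumes "\<And>x. x \<in> X \<Longrightarrow> 0 \<le> h x" "\<And>F. finite F \<Longrightarrow> F \<subseteq> X \<Longrightarrow> sum h F \<le> r"
  shows "h summable_on X"
  using assms by (intro nonneg_bdd_above_summable_on) (auto intro!: bdd_aboveI[of _ r])

lemma ell_norm_nonneg: "0 \<le> ell_norm p G f"
  by (simp add: ell_norm_def)

lemma not_summable_on_pos_const:
  fixes c :: real
  assumes "infinite X" "0 < c"
  shows "\<not> (\<lambda>x. c) summable_on X"
proof
  assume summ: "(\<lambda>x. c) summable_on X"
  obtain n where n: "(\<Sum>\<^sub>\<infinity>x\<in>X. c) < real n * c"
    using reals_Archimedean3[OF assms(2)] by blast
  obtain F where "finite F" "card F = n" "F \<subseteq> X"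
    using infinite_arbitrarily_large[OF assms(1)] by blast
  then have "real n * c \<le> (\<Sum>\<^sub>\<infinity>x\<in>X. c)"
    using finite_sum_le_infsum[OF summ, of F] assms(2) by simp
  with n show False by simp
qed

text \<open>Since v vanishes off the finite set F, the sum splits into finitely many terms depending
  on t and a tail independent of t. Thus no limit has to be exchanged with an infinite sum.\<close>

lemma DERIV_infsum_cmod_powr:
  assumes "1 < p" and "(\<lambda>x. cmod (u x) powr p) summable_on X"
    and F: "finite F" "F \<subseteq> X" and v: "\<And>x. x \<in> X - F \<Longrightarrow> v x = 0"
  shows "((\<lambda>t::real. \<Sum>\<^sub>\<infinity>x\<in>X. cmod (u x + of_real t * v x) powr p) has_real_derivative
           p * (\<Sum>x\<in>F. Re (duality_map p (u x) * cnj (v x)))) (at 0)"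
proof -
  have "(\<Sum>\<^sub>\<infinity>x\<in>X. cmod (u x + of_real t * v x) powr p) =
      (\<Sum>x\<in>F. cmod (u x + of_real t * v x) powr p) + (\<Sum>\<^sub>\<infinity>x\<in>X - F. cmod (u x) powr p)" for t
  proof -
    have eq: "(\<Sum>\<^sub>\<infinity>x\<in>X - F. cmod (u x + of_real t * v x) powr p) = (\<Sum>\<^sub>\<infinity>x\<in>X - F. cmod (u x) powr p)"
      by (rule infsum_cong) (simp add: v)
    have "(\<lambda>x. cmod (u x + of_real t * v x) powr p) summable_on X - F"
      using summable_on_subset_banach[OF assms(2), of "X - F"]
      by (subst summable_on_cong[where g = "\<lambda>x. cmod (u x) powr p"]) (auto simp: v)
    then have "(\<Sum>\<^sub>\<infinity>x\<in>F \<union> (X - F). cmod (u x + of_real t * v x) powr p) =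
      (\<Sum>\<^sub>\<infinity>x\<in>F. cmod (u x + of_real t * v x) powr p) +
      (\<Sum>\<^sub>\<infinity>x\<in>X - F. cmod (u x + of_real t * v x) powr p)"
      by (intro infsum_Un_disjoint) (use F in auto)
    moreover have "F \<union> (X - F) = X" using F by auto
    ultimately show ?thesis using F eq by simp
  qed
  moreover have "((\<lambda>t. (\<Sum>x\<in>F. cmod (u x + of_real t * v x) powr p) +
      (\<Sum>\<^sub>\<infinity>x\<in>X - F. cmod (u x) powr p)) has_real_derivative
      (\<Sum>x\<in>F. p * Re (duality_map p (u x) * cnj (v x))) + 0) (at 0)"
    by (intro DERIV_add DERIV_sum DERIV_cmod_powr DERIV_const assms(1))
  ultimately show ?thesis by (simp only: sum_distrib_left add_0_right)
qed

section \<open>Minimisation on compact sets of functions\<close>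

lemma compact_lower_semicontinuous_attains_inf:
  fixes \<Phi> :: "'a::topological_space \<Rightarrow> 'b::linorder"
  assumes "compact S" "S \<noteq> {}" and closed: "\<And>c. closed {x \<in> S. \<Phi> x \<le> c}"
  shows "\<exists>x\<in>S. \<forall>y\<in>S. \<Phi> x \<le> \<Phi> y"
proof (rule ccontr)
  assume "\<not> ?thesis"
  then have "\<forall>x\<in>S. \<exists>y\<in>S. \<Phi> y < \<Phi> x" by (meson not_le)
  then have "S \<subseteq> (\<Union>y\<in>S. - {x \<in> S. \<Phi> x \<le> \<Phi> y})" by fastforce
  then obtain T where T: "T \<subseteq> S" "finite T" "S \<subseteq> (\<Union>y\<in>T. - {x \<in> S. \<Phi> x \<le> \<Phi> y})"
    by (rule compactE_image[OF assms(1) open_Compl[OF closed]])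
  then have "T \<noteq> {}" using assms(2) by auto
  define y where "y = arg_min_on \<Phi> T"
  have "y \<in> T" "\<And>z. z \<in> T \<Longrightarrow> \<Phi> y \<le> \<Phi> z"
    using arg_min_if_finite[OF T(2) \<open>T \<noteq> {}\<close>, of \<Phi>] by (auto simp: y_def not_less)
  with T show False by blast
qed

text \<open>Tychonoff's theorem, transferred to the function type, whose topology is that of
  pointwise convergence.\<close>

lemma compact_PiE_UNIV:
  fixes B :: "'a \<Rightarrow> 'b::topological_space set"
  assumes "\<And>x. compact (B x)"
  shows "compact (PiE UNIV B)"
  using compactin_PiE[of "\<lambda>_. euclidean" UNIV B] assms
  by (simp add: euclidean_product_topology)

subsection \<open>Summation by parts\<close>

locale weighted_group = group G for G (structure) +
  fixes K :: "'a set" and m :: "'a \<Rightarrow> real" and p q :: real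
  assumes K_subset: "K \<subseteq> carrier G" and finite_K: "finite K"
    and K_symmetric: "symmetric_set G K" and weight: "symmetric_weight G K m"
    and p_gt_1: "1 < p" and q_eq: "q = p / (p - 1)"
begin

text \<open>The p-th power of the Dirichlet norm, as \<open>dirichlet_norm_eq\<close> records.
  Without the root it is a combination of sums that can be differentiated directly.\<close>

definition energy :: "('a \<Rightarrow> complex) \<Rightarrow> real" where
  "energy f = (\<Sum>\<gamma>\<in>K. m \<gamma> * (\<Sum>\<^sub>\<infinity>x\<in>carrier G. cmod (grad G f \<gamma> x) powr p))"

lemma q_gt_1: "1 < q" and conjugate: "1 / p + 1 / q = 1"
  using p_gt_1 by (auto simp: q_eq field_simps)

lemma weight_pos: "\<gamma> \<in> K \<Longrightarrow> 0 < m \<gamma>"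
  using weight by (auto simp: symmetric_weight_def)

lemma sum_weight: "(\<Sum>\<gamma>\<in>K. m \<gamma>) = 1"
  using weight by (auto simp: symmetric_weight_def)

lemma K_carrier: "\<gamma> \<in> K \<Longrightarrow> \<gamma> \<in> carrier G"
  using K_subset by auto

text \<open>Symmetry of K and m makes inversion a weight-preserving permutation of K. The values lie
  in a general algebra because both complex pairings and real derivatives are symmetrised this
  way.\<close>

lemma sum_inverse: "(\<Sum>\<gamma>\<in>K. of_real (m \<gamma>) * h (inv \<gamma>)) = (\<Sum>\<gamma>\<in>K. of_real (m \<gamma>) * h \<gamma>)"
  for h :: "'a \<Rightarrow> 'c::real_algebra_1"
proof (rule sum.reindex_bij_witness[where i = "\<lambda>\<gamma>. inv \<gamma>" and j = "\<lambda>\<gamma>. inv \<gamma>"])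
  show "inv \<gamma> \<in> K" if "\<gamma> \<in> K" for \<gamma>
    using K_symmetric that by (auto simp: symmetric_set_def)
  then show "inv \<gamma> \<in> K" if "\<gamma> \<in> K" for \<gamma> using that .
  show "of_real (m (inv \<gamma>)) * h (inv \<gamma>) = of_real (m \<gamma>) * h (inv \<gamma>)" if "\<gamma> \<in> K" for \<gamma>
    using weight that by (auto simp: symmetric_weight_def)
qed (use K_carrier in auto)

lemma dirichlet_norm_eq: "dirichlet_norm p G K m f = energy f powr (1 / p)"
  using p_gt_1 by (simp add: dirichlet_norm_def energy_def ell_norm_powr mult.commute)

lemma energy_nonneg: "0 \<le> energy f"
  unfolding energy_def
  by (intro sum_nonneg mult_nonneg_nonneg infsum_nonneg) (auto intro: less_imp_le weight_pos)

lemma grad_summable: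
  assumes "f \<in> ell p G" "\<gamma> \<in> carrier G"
  shows "(\<lambda>x. cmod (grad G f \<gamma> x) powr p) summable_on carrier G"
  using ell_grad[OF _ assms(2,1)] p_gt_1 by (simp add: ell_def)

lemma p_laplacian_ell:
  assumes "f \<in> ell p G"
  shows "p_laplacian p G K m f \<in> ell q G"
  using ell_sum[OF _ finite_K, of q "\<lambda>\<gamma> x. of_real (m \<gamma>) * duality_map p (grad G f \<gamma> x)" G]
    ell_cmult[OF duality_map_ell[OF p_gt_1 q_eq ell_grad[OF _ K_carrier assms]]] p_gt_1 q_gt_1
  by (simp add: p_laplacian_eq[abs_def])

text \<open>The pair x, \<open>\<gamma> \<otimes> x\<close> is seen from both ends, with opposite
  signs. This antisymmetry causes the factor 2 in the summation by parts and in the first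
  variation.\<close>

lemma grad_mult_left:
  assumes "\<gamma> \<in> carrier G" "x \<in> carrier G"
  shows "grad G f \<gamma> (\<gamma> \<otimes> x) = - grad G f (inv \<gamma>) x"
  using assms by (simp add: grad_apply m_assoc[symmetric])

text \<open>Substituting \<open>\<gamma> \<otimes> x\<close> for x turns \<open>S \<gamma>\<close>
  into minus the pairing of the dual of the difference at \<open>inv \<gamma>\<close> with a
  translate of f. Adding \<open>S (inv \<gamma>)\<close> completes f to its own difference, and
  \<open>duality_map_mult_cnj\<close> yields p-th powers.\<close>

lemma infsum_duality_grad:
  assumes f: "f \<in> ell p G" and \<gamma>: "\<gamma> \<in> carrier G"
  defines "S \<equiv> \<lambda>\<gamma>. \<Sum>\<^sub>\<infinity>x\<in>carrier G. duality_map p (grad G f \<gamma> x) * cnj (f x)"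
  shows "S \<gamma> + S (inv \<gamma>) = - of_real (\<Sum>\<^sub>\<infinity>x\<in>carrier G. cmod (grad G f (inv \<gamma>) x) powr p)"
proof -
  let ?d = "grad G f (inv \<gamma>)"
  have summ: "(\<lambda>x. duality_map p (?d x) * cnj (g x)) summable_on carrier G" if "g \<in> ell p G" for g
    using p_gt_1 \<gamma> f that
    by (intro ell_mult_cnj_summable[OF p_gt_1 q_gt_1 conjugate] duality_map_ell q_eq ell_grad) auto
  have shift: "left_regular G (inv \<gamma>) f \<in> ell p G"
    using ell_left_regular[OF _ f] \<gamma> by simp
  have "S \<gamma> = (\<Sum>\<^sub>\<infinity>x\<in>carrier G. duality_map p (grad G f \<gamma> (\<gamma> \<otimes> x)) * cnj (f (\<gamma> \<otimes> x)))"
    unfolding S_def by (rule infsum_reindex_bij_betw[OF bij_betw_left_mult[OF \<gamma>], symmetric])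
  also have "\<dots> = (\<Sum>\<^sub>\<infinity>x\<in>carrier G. - (duality_map p (?d x) * cnj (left_regular G (inv \<gamma>) f x)))"
    by (intro infsum_cong) (simp add: grad_mult_left \<gamma> duality_map_minus left_regular_def)
  finally have "S \<gamma> + S (inv \<gamma>) = (\<Sum>\<^sub>\<infinity>x\<in>carrier G.
      - (duality_map p (?d x) * cnj (left_regular G (inv \<gamma>) f x)) + duality_map p (?d x) * cnj (f x))"
    unfolding S_def
    by (subst infsum_add) (auto simp: infsum_uminus intro!: summ shift f summable_on_uminus[THEN iffD2])
  also have "\<dots> = - (\<Sum>\<^sub>\<infinity>x\<in>carrier G. of_real (cmod (?d x) powr p))"
    unfolding infsum_uminus[symmetric]
    by (intro infsum_cong) (simp add: duality_map_mult_cnj[symmetric] grad_def algebra_simps)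
  also have "(\<Sum>\<^sub>\<infinity>x\<in>carrier G. complex_of_real (cmod (?d x) powr p)) =
      of_real (\<Sum>\<^sub>\<infinity>x\<in>carrier G. cmod (?d x) powr p)"
    using grad_summable[OF f inv_closed[OF \<gamma>]] by (intro infsumI) (simp add: has_sum_of_real_iff)
  finally show ?thesis .
qed

text \<open>By \<open>sum_inverse\<close>, doubling the weighted sum of \<open>S \<gamma>\<close>
  over K gives the weighted sum of \<open>S \<gamma> + S (inv \<gamma>)\<close>, to which
  \<open>infsum_duality_grad\<close> applies term by term.\<close>

lemma infsum_p_laplacian_mult_cnj:
  assumes f: "f \<in> ell p G"
  shows "2 * (\<Sum>\<^sub>\<infinity>x\<in>carrier G. p_laplacian p G K m f x * cnj (f x)) = - of_real (energy f)"
proof -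
  define S where "S = (\<lambda>\<gamma>. \<Sum>\<^sub>\<infinity>x\<in>carrier G. duality_map p (grad G f \<gamma> x) * cnj (f x))"
  have summ: "(\<lambda>x. duality_map p (grad G f \<gamma> x) * cnj (f x)) summable_on carrier G" if "\<gamma> \<in> K" for \<gamma>
    using p_gt_1 K_carrier[OF that] f
    by (intro ell_mult_cnj_summable[OF p_gt_1 q_gt_1 conjugate] duality_map_ell q_eq ell_grad) auto
  have "(\<Sum>\<^sub>\<infinity>x\<in>carrier G. p_laplacian p G K m f x * cnj (f x)) =
      (\<Sum>\<^sub>\<infinity>x\<in>carrier G. \<Sum>\<gamma>\<in>K. of_real (m \<gamma>) * (duality_map p (grad G f \<gamma> x) * cnj (f x)))"
    by (simp add: p_laplacian_eq sum_distrib_right mult.assoc)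
  also have "\<dots> = (\<Sum>\<gamma>\<in>K. \<Sum>\<^sub>\<infinity>x\<in>carrier G. of_real (m \<gamma>) * (duality_map p (grad G f \<gamma> x) * cnj (f x)))"
    by (intro infsumI has_sum_finite_sum has_sum_infsum summable_on_cmult_right summ finite_K)
  also have "\<dots> = (\<Sum>\<gamma>\<in>K. of_real (m \<gamma>) * S \<gamma>)"
    unfolding S_def by (intro sum.cong refl infsum_cmult_right) (auto intro: summ)
  finally have *: "(\<Sum>\<^sub>\<infinity>x\<in>carrier G. p_laplacian p G K m f x * cnj (f x)) = (\<Sum>\<gamma>\<in>K. of_real (m \<gamma>) * S \<gamma>)" .
  have "2 * (\<Sum>\<gamma>\<in>K. of_real (m \<gamma>) * S \<gamma>) = (\<Sum>\<gamma>\<in>K. of_real (m \<gamma>) * (S \<gamma> + S (inv \<gamma>)))"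
    using sum_inverse[of S] by (simp add: distrib_left sum.distrib)
  also have "\<dots> = - (\<Sum>\<gamma>\<in>K. of_real (m \<gamma>) * of_real (\<Sum>\<^sub>\<infinity>x\<in>carrier G. cmod (grad G f (inv \<gamma>) x) powr p))"
    unfolding S_def using infsum_duality_grad[OF f K_carrier] by (simp add: sum_negf)
  also have "\<dots> = - of_real (energy f)"
    using sum_inverse[of "\<lambda>\<gamma>. complex_of_real (\<Sum>\<^sub>\<infinity>x\<in>carrier G. cmod (grad G f \<gamma> x) powr p)"]
    by (simp add: energy_def)
  finally show ?thesis using * by simp
qed

lemma energy_le_infsum_p_laplacian:
  assumes f: "f \<in> ell p G"
  shows "energy f \<le> 2 * (\<Sum>\<^sub>\<infinity>x\<in>carrier G. cmod (f x) * cmod (p_laplacian p G K m f x))"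
proof -
  have "(\<lambda>x. cmod (f x) * cmod (p_laplacian p G K m f x)) summable_on carrier G"
    by (rule ell_mult_abs_summable[OF p_gt_1 q_gt_1 conjugate f p_laplacian_ell[OF f]])
  then have "cmod (\<Sum>\<^sub>\<infinity>x\<in>carrier G. p_laplacian p G K m f x * cnj (f x)) \<le>
      (\<Sum>\<^sub>\<infinity>x\<in>carrier G. cmod (p_laplacian p G K m f x * cnj (f x)))"
    by (intro norm_infsum_bound) (simp add: norm_mult mult.commute)
  moreover have "cmod (2 * (\<Sum>\<^sub>\<infinity>x\<in>carrier G. p_laplacian p G K m f x * cnj (f x))) = energy f"
    unfolding infsum_p_laplacian_mult_cnj[OF f] using energy_nonneg by simp
  ultimately show ?thesis by (simp add: norm_mult mult.commute)
qed

subsection \<open>The penalized minimisation problem\<close>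

definition penalized :: "('a \<Rightarrow> complex) \<Rightarrow> real \<Rightarrow> ('a \<Rightarrow> complex) \<Rightarrow> real" where
  "penalized f\<^sub>0 \<kappa> g =
     energy g powr (1 / p) + \<kappa> * (\<Sum>\<^sub>\<infinity>x\<in>carrier G. cmod (g x - f\<^sub>0 x) powr p)"

text \<open>A truncation that sees only finitely many coordinates of g, hence is continuous for
  pointwise convergence. The full functional is the supremum of these, which makes it lower
  semicontinuous.\<close>

definition partial_penalized :: "('a \<Rightarrow> complex) \<Rightarrow> real \<Rightarrow> 'a set \<Rightarrow> ('a \<Rightarrow> complex) \<Rightarrow> real" where
  "partial_penalized f\<^sub>0 \<kappa> F g =
     (\<Sum>\<gamma>\<in>K. m \<gamma> * (\<Sum>x\<in>F. cmod (grad G g \<gamma> x) powr p)) powr (1 / p) +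
     \<kappa> * (\<Sum>x\<in>F. cmod (g x - f\<^sub>0 x) powr p)"

lemma diff_summable:
  assumes "f \<in> ell p G" "g \<in> ell p G"
  shows "(\<lambda>x. cmod (f x - g x) powr p) summable_on carrier G"
  using ell_diff[OF _ assms] p_gt_1 by (simp add: ell_def)

lemma partial_penalized_le:
  assumes "f\<^sub>0 \<in> ell p G" "g \<in> ell p G" "0 \<le> \<kappa>" "finite F" "F \<subseteq> carrier G"
  shows "partial_penalized f\<^sub>0 \<kappa> F g \<le> penalized f\<^sub>0 \<kappa> g"
  unfolding partial_penalized_def penalized_def energy_def
proof (intro add_mono powr_mono2 sum_mono mult_left_mono)
  show "0 \<le> (\<Sum>\<gamma>\<in>K. m \<gamma> * (\<Sum>x\<in>F. cmod (grad G g \<gamma> x) powr p))"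
    by (intro sum_nonneg mult_nonneg_nonneg) (auto intro: less_imp_le weight_pos)
qed (use assms p_gt_1 in \<open>auto intro!: finite_sum_le_infsum grad_summable diff_summable K_carrier
    intro: less_imp_le weight_pos\<close>)

lemma tendsto_partial_penalized:
  assumes "f\<^sub>0 \<in> ell p G" "g \<in> ell p G"
  shows "((\<lambda>F. partial_penalized f\<^sub>0 \<kappa> F g) \<longlongrightarrow> penalized f\<^sub>0 \<kappa> g) (finite_subsets_at_top (carrier G))"
  unfolding partial_penalized_def penalized_def energy_def
\<comment> \<open>The limiting energy may be 0, so continuity of the root there is obtained from the
  positive exponent and nonnegative truncated energies; this is the branch chosen by
  \<open>disjI2\<close>.\<close>
proof (intro tendsto_add tendsto_powr' tendsto_mult tendsto_sum tendsto_const infsum_tendsto disjI2 conjI)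
  show "\<forall>\<^sub>F F in finite_subsets_at_top (carrier G).
      0 \<le> (\<Sum>\<gamma>\<in>K. m \<gamma> * (\<Sum>x\<in>F. cmod (grad G g \<gamma> x) powr p))"
    by (intro always_eventually allI sum_nonneg mult_nonneg_nonneg)
      (auto intro: less_imp_le weight_pos)
qed (use assms p_gt_1 in \<open>auto intro!: grad_summable diff_summable K_carrier\<close>)

text \<open>Truncations lie below the full functional and converge to it, so upper bounds pass both
  ways. Sublevel sets thereby become intersections of closed conditions.\<close>

lemma penalized_le_iff:
  assumes "f\<^sub>0 \<in> ell p G" "g \<in> ell p G" "0 \<le> \<kappa>"
  shows "penalized f\<^sub>0 \<kappa> g \<le> c \<longleftrightarrow>
    (\<forall>F\<in>{F. finite F \<and> F \<subseteq> carrier G}. partial_penalized f\<^sub>0 \<kappa> F g \<le> c)"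
proof
  assume R: "\<forall>F\<in>{F. finite F \<and> F \<subseteq> carrier G}. partial_penalized f\<^sub>0 \<kappa> F g \<le> c"
  show "penalized f\<^sub>0 \<kappa> g \<le> c"
    by (rule tendsto_upperbound[OF tendsto_partial_penalized[OF assms(1,2)]])
      (auto intro!: eventually_finite_subsets_at_top_weakI simp: R)
qed (use partial_penalized_le[OF assms] in force)

lemma continuous_on_diff_powr:
  "continuous_on UNIV (\<lambda>g::'a \<Rightarrow> complex. cmod (g x - f\<^sub>0 x) powr p)"
  using p_gt_1 by (intro continuous_on_powr' continuous_intros) auto

lemma continuous_on_partial_penalized:
  "continuous_on UNIV (partial_penalized f\<^sub>0 \<kappa> F)"
proof -
  have "continuous_on UNIV (\<lambda>g::'a \<Rightarrow> complex. grad G g \<gamma> x)" for \<gamma> x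
    unfolding grad_apply by (intro continuous_intros continuous_on_product_coordinates)
  then have "continuous_on UNIV
      (\<lambda>g. (\<Sum>\<gamma>\<in>K. m \<gamma> * (\<Sum>x\<in>F. cmod (grad G g \<gamma> x) powr p)) powr (1 / p))"
    using p_gt_1
    by (intro continuous_on_powr' continuous_intros)
      (auto intro!: sum_nonneg mult_nonneg_nonneg intro: less_imp_le weight_pos)
  then show ?thesis
    unfolding partial_penalized_def
    by (intro continuous_on_add continuous_on_mult continuous_on_sum continuous_on_const
        continuous_on_diff_powr)
qed

text \<open>
  Sublevel sets are compact for pointwise convergence, being cut out of a product of discs by
  conditions on finite partial sums; so no completeness or reflexivity of $\ell^p$ is needed.
\<close>

lemma penalized_attains_minimum:
  assumes f\<^sub>0: "f\<^sub>0 \<in> ell p G" and \<kappa>: "0 < \<kappa>"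
  defines "T \<equiv> {g \<in> ell p G. \<forall>x. x \<notin> carrier G \<longrightarrow> g x = f\<^sub>0 x}"
  shows "\<exists>f\<in>T. \<forall>g\<in>T. penalized f\<^sub>0 \<kappa> f \<le> penalized f\<^sub>0 \<kappa> g"
proof -
  \<comment> \<open>Any g whose functional is at most that of \<open>f\<^sub>0\<close> has penalty
    sum at most r, because the energy term is nonnegative.\<close>
  define r where "r = penalized f\<^sub>0 \<kappa> f\<^sub>0 / \<kappa>"
  define Fin where "Fin = {F. finite F \<and> F \<subseteq> carrier G}"
  define S where "S = {g. (\<forall>x\<in>- carrier G. g x = f\<^sub>0 x) \<and>
    (\<forall>F\<in>Fin. (\<Sum>x\<in>F. cmod (g x - f\<^sub>0 x) powr p) \<le> r)}"
  have r0: "0 \<le> r" using \<kappa> p_gt_1 by (simp add: r_def penalized_def)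
  then have f\<^sub>0_S: "f\<^sub>0 \<in> S" using p_gt_1 by (simp add: S_def)
  have ST: "S \<subseteq> T"
  proof
    fix g assume g: "g \<in> S"
    then have "(\<lambda>x. cmod (g x - f\<^sub>0 x) powr p) summable_on carrier G"
      by (intro summable_on_bounded_sums[of _ _ r]) (auto simp: S_def Fin_def)
    then have "(\<lambda>x. (g x - f\<^sub>0 x) + f\<^sub>0 x) \<in> ell p G"
      using f\<^sub>0 p_gt_1 by (intro ell_add) (auto simp: ell_def)
    then show "g \<in> T" using g by (simp add: T_def S_def)
  qed
  have S_eq: "S = (\<Inter>x\<in>- carrier G. {g. g x = f\<^sub>0 x}) \<inter>
      (\<Inter>F\<in>Fin. {g. (\<Sum>x\<in>F. cmod (g x - f\<^sub>0 x) powr p) \<le> r})"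
    by (auto simp: S_def)
  have "closed S"
    unfolding S_eq
    by (intro closed_Int closed_INT ballI closed_Collect_eq closed_Collect_le continuous_on_sum
        continuous_on_const continuous_on_diff_powr continuous_on_product_coordinates)
  moreover have "S \<subseteq> PiE UNIV (\<lambda>x. cball (f\<^sub>0 x) (r powr (1 / p)))"
  proof
    fix g assume g: "g \<in> S"
    have "cmod (g x - f\<^sub>0 x) \<le> r powr (1 / p)" for x
    proof (cases "x \<in> carrier G")
      case True
      \<comment> \<open>The condition for a single point confines each coordinate to a disc.\<close>
      then have "{x} \<in> Fin" by (simp add: Fin_def)
      then have "cmod (g x - f\<^sub>0 x) powr p \<le> r" using g by (fastforce simp: S_def)
      then have "(cmod (g x - f\<^sub>0 x) powr p) powr (1 / p) \<le> r powr (1 / p)"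
        using p_gt_1 by (intro powr_mono2) auto
      then show ?thesis using p_gt_1 by (simp add: powr_powr)
    qed (use g in \<open>simp add: S_def\<close>)
    then show "g \<in> PiE UNIV (\<lambda>x. cball (f\<^sub>0 x) (r powr (1 / p)))"
      by (simp add: PiE_iff dist_norm norm_minus_commute)
  qed
  moreover have "compact (PiE UNIV (\<lambda>x. cball (f\<^sub>0 x) (r powr (1 / p))))"
    by (intro compact_PiE_UNIV compact_cball)
  ultimately have "compact S"
    using compact_Int_closed Int_absorb1 by metis
  moreover have "closed {g \<in> S. penalized f\<^sub>0 \<kappa> g \<le> c}" for c
  proof -
    have "{g \<in> S. penalized f\<^sub>0 \<kappa> g \<le> c} = S \<inter> (\<Inter>F\<in>Fin. {g. partial_penalized f\<^sub>0 \<kappa> F g \<le> c})"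
      using penalized_le_iff[OF f\<^sub>0] ST \<kappa> by (auto simp: Fin_def T_def subset_eq)
    then show ?thesis
      using \<open>closed S\<close>
      by (auto intro!: closed_Int closed_INT closed_Collect_le continuous_on_partial_penalized
          continuous_on_const)
  qed
  ultimately obtain f where f: "f \<in> S" "\<And>g. g \<in> S \<Longrightarrow> penalized f\<^sub>0 \<kappa> f \<le> penalized f\<^sub>0 \<kappa> g"
    using compact_lower_semicontinuous_attains_inf[of S "penalized f\<^sub>0 \<kappa>"] f\<^sub>0_S by blast
  \<comment> \<open>A competitor in T that beats f also beats \<open>f\<^sub>0\<close>; it then
    satisfies the bounds defining S, where f is already minimal.\<close>
  have "penalized f\<^sub>0 \<kappa> f \<le> penalized f\<^sub>0 \<kappa> g" if g: "g \<in> T" for g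
  proof (rule ccontr)
    assume "\<not> ?thesis"
    then have lt: "penalized f\<^sub>0 \<kappa> g < penalized f\<^sub>0 \<kappa> f\<^sub>0" using f(2)[OF f\<^sub>0_S] by simp
    have "(\<Sum>x\<in>F. cmod (g x - f\<^sub>0 x) powr p) \<le> r" if "F \<in> Fin" for F
    proof -
      have "(\<Sum>x\<in>F. cmod (g x - f\<^sub>0 x) powr p) \<le> (\<Sum>\<^sub>\<infinity>x\<in>carrier G. cmod (g x - f\<^sub>0 x) powr p)"
        using that g f\<^sub>0 by (intro finite_sum_le_infsum diff_summable) (auto simp: Fin_def T_def)
      also have "\<dots> \<le> penalized f\<^sub>0 \<kappa> g / \<kappa>"
        using \<kappa> by (simp add: penalized_def field_simps)
      also have "\<dots> \<le> r" unfolding r_def using lt \<kappa> by (intro divide_right_mono) auto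
      finally show ?thesis .
    qed
    then have "g \<in> S" using g by (simp add: S_def T_def)
    with f(2) \<open>\<not> ?thesis\<close> show False by blast
  qed
  with f(1) ST show ?thesis by blast
qed

section \<open>First variation and the Euler-Lagrange equation\<close>

text \<open>Moving f at the single point x alters the difference at \<open>\<gamma>\<close> only at
  x and at \<open>\<gamma> \<otimes> x\<close>. By \<open>grad_mult_left\<close> the second
  contribution is that of \<open>inv \<gamma>\<close> at x, so after summation over the symmetric K
  both give the p-Laplacian at x.\<close>

lemma DERIV_energy_single:
  fixes z :: complex
  assumes f: "f \<in> ell p G" and x: "x \<in> carrier G"
  defines "v \<equiv> \<lambda>y. if y = x then z else 0"
  shows "((\<lambda>t::real. energy (\<lambda>y. f y + of_real t * v y)) has_real_derivative
           - 2 * p * Re (p_laplacian p G K m f x * cnj z)) (at 0)"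
proof -
  define D where "D = (\<lambda>\<gamma>. Re ((- duality_map p (grad G f (inv \<gamma>) x) - duality_map p (grad G f \<gamma> x)) * cnj z))"
  have deriv: "((\<lambda>t::real. \<Sum>\<^sub>\<infinity>y\<in>carrier G. cmod (grad G f \<gamma> y + of_real t * grad G v \<gamma> y) powr p)
      has_real_derivative p * D \<gamma>) (at 0)" if "\<gamma> \<in> K" for \<gamma>
  proof -
    have \<gamma>: "\<gamma> \<in> carrier G" using K_carrier that .
    have gv: "grad G v \<gamma> y = (if y = \<gamma> \<otimes> x then z else 0) - (if y = x then z else 0)"
      if "y \<in> carrier G" for y
    proof -
      have "inv \<gamma> \<otimes> y = x \<longleftrightarrow> y = \<gamma> \<otimes> x"
        using inv_solve_left'[OF \<gamma> that x] \<gamma> that x by (metis inv_solve_left)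
      then show ?thesis by (simp add: grad_apply v_def)
    qed
    have "(\<Sum>y\<in>{x, \<gamma> \<otimes> x}. Re (duality_map p (grad G f \<gamma> y) * cnj (grad G v \<gamma> y))) = D \<gamma>"
    \<comment> \<open>Equality means that \<open>\<gamma>\<close> is the identity, which K may
      contain: the two points merge, the gradient of v vanishes at x, and the two terms of
      \<open>D \<gamma>\<close> cancel.\<close>
    proof (cases "\<gamma> \<otimes> x = x")
      case True
      then have "grad G f \<gamma> x = - grad G f (inv \<gamma>) x"
        using grad_mult_left[OF \<gamma> x, of f] by simp
      then show ?thesis using True x by (simp add: gv D_def duality_map_minus)
    next
      case False
      then have "grad G v \<gamma> (\<gamma> \<otimes> x) = z" "grad G v \<gamma> x = - z"
        using x \<gamma> by (auto simp: gv)
      then show ?thesis using False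
        by (simp add: D_def duality_map_minus grad_mult_left[OF \<gamma> x, of f] algebra_simps)
    qed
    moreover have "((\<lambda>t::real. \<Sum>\<^sub>\<infinity>y\<in>carrier G. cmod (grad G f \<gamma> y + of_real t * grad G v \<gamma> y) powr p)
        has_real_derivative p * (\<Sum>y\<in>{x, \<gamma> \<otimes> x}. Re (duality_map p (grad G f \<gamma> y) * cnj (grad G v \<gamma> y)))) (at 0)"
      using x \<gamma> by (intro DERIV_infsum_cmod_powr p_gt_1 grad_summable f) (auto simp: gv)
    ultimately show ?thesis by simp
  qed
  have "grad G (\<lambda>y. f y + of_real t * v y) \<gamma> y = grad G f \<gamma> y + of_real t * grad G v \<gamma> y" for t \<gamma> y
    by (simp add: grad_apply algebra_simps)
  then have "energy (\<lambda>y. f y + of_real t * v y) = (\<Sum>\<gamma>\<in>K. m \<gamma> *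
      (\<Sum>\<^sub>\<infinity>y\<in>carrier G. cmod (grad G f \<gamma> y + of_real t * grad G v \<gamma> y) powr p))" for t
    by (simp add: energy_def)
  moreover have "((\<lambda>t. \<Sum>\<gamma>\<in>K. m \<gamma> *
      (\<Sum>\<^sub>\<infinity>y\<in>carrier G. cmod (grad G f \<gamma> y + of_real t * grad G v \<gamma> y) powr p)) has_real_derivative
      (\<Sum>\<gamma>\<in>K. m \<gamma> * (p * D \<gamma>))) (at 0)"
    by (intro DERIV_sum DERIV_cmult deriv)
  moreover have "(\<Sum>\<gamma>\<in>K. m \<gamma> * (p * D \<gamma>)) = - 2 * p * Re (p_laplacian p G K m f x * cnj z)"
  proof -
    define h where "h = (\<lambda>\<gamma>. Re (duality_map p (grad G f \<gamma> x) * cnj z))"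
    have "(\<Sum>\<gamma>\<in>K. m \<gamma> * (p * D \<gamma>)) = - p * ((\<Sum>\<gamma>\<in>K. m \<gamma> * h (inv \<gamma>)) + (\<Sum>\<gamma>\<in>K. m \<gamma> * h \<gamma>))"
      unfolding sum.distrib[symmetric] sum_distrib_left
      by (intro sum.cong) (simp_all add: D_def h_def algebra_simps)
    also have "\<dots> = - 2 * p * (\<Sum>\<gamma>\<in>K. m \<gamma> * h \<gamma>)"
      using sum_inverse[of h] by simp
    also have "(\<Sum>\<gamma>\<in>K. m \<gamma> * h \<gamma>) = Re (p_laplacian p G K m f x * cnj z)"
      unfolding p_laplacian_eq sum_distrib_right Re_sum h_def
      by (intro sum.cong) (simp_all add: algebra_simps)
    finally show ?thesis .
  qed
  ultimately show ?thesis by simp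
qed

text \<open>Zero energy makes f invariant under K, hence under the group it generates, hence
  constant; a nonzero constant is not p-summable on an infinite group.\<close>

lemma energy_pos:
  assumes "infinite (carrier G)" "generate G K = carrier G" "f \<in> ell p G"
    and "x \<in> carrier G" "f x \<noteq> 0"
  shows "0 < energy f"
proof (rule ccontr)
  assume "\<not> ?thesis"
  then have "energy f = 0" using energy_nonneg[of f] by simp
  then have "\<And>\<gamma>. \<gamma> \<in> K \<Longrightarrow> m \<gamma> * (\<Sum>\<^sub>\<infinity>x\<in>carrier G. cmod (grad G f \<gamma> x) powr p) = 0"
    unfolding energy_def
    by (subst (asm) sum_nonneg_eq_0_iff[OF finite_K])
      (auto intro!: mult_nonneg_nonneg infsum_nonneg intro: less_imp_le weight_pos)
  then have zero: "(\<Sum>\<^sub>\<infinity>x\<in>carrier G. cmod (grad G f \<gamma> x) powr p) \<le> 0" if "\<gamma> \<in> K" for \<gamma>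
    using that weight_pos[OF that] by fastforce
  have "grad G f \<gamma> y = 0" if "\<gamma> \<in> K" "y \<in> carrier G" for \<gamma> y
    using nonneg_infsum_le_0D[OF zero[OF that(1)] grad_summable[OF assms(3) K_carrier[OF that(1)]] _ that(2)]
    by simp
  then have inv: "f (inv \<gamma> \<otimes> y) = f y" if "\<gamma> \<in> K" "y \<in> carrier G" for \<gamma> y
    using that by (simp add: grad_apply)
  have const: "\<forall>y\<in>carrier G. f (h \<otimes> y) = f y" if "h \<in> generate G K" for h
    using that
  proof (induction rule: generate.induct)
    case (incl h)
    show ?case
    proof
      fix y assume y: "y \<in> carrier G"
      show "f (h \<otimes> y) = f y"
        using inv[OF incl, of "h \<otimes> y"] y K_carrier[OF incl] by (simp add: m_assoc[symmetric])
    qed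
  next
    case (eng h1 h2)
    then have "h1 \<in> carrier G" "h2 \<in> carrier G" using assms(2) by auto
    with eng show ?case by (simp add: m_assoc)
  qed (use inv in auto)
  have "f y = f x" if "y \<in> carrier G" for y
  proof -
    have "f ((y \<otimes> inv x) \<otimes> x) = f x"
      using const that assms(2,4) by (metis inv_closed m_closed)
    then show ?thesis using that assms(4) by (simp add: m_assoc)
  qed
  then have "(\<lambda>y. cmod (f x) powr p) summable_on carrier G"
    using assms(3) by (simp add: ell_def cong: summable_on_cong)
  then show False
    using not_summable_on_pos_const[OF assms(1), of "cmod (f x) powr p"] assms(5) by simp
qed

text \<open>Perturbations at one point suffice, since the equation is pointwise. Positive energy is
  what makes the p-th root of the energy differentiable at f.\<close>

lemma euler_lagrange:
  assumes f\<^sub>0: "f\<^sub>0 \<in> ell p G" and \<kappa>: "0 < \<kappa>" and f: "f \<in> ell p G" and pos: "0 < energy f"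
    and min: "\<And>g. g \<in> ell p G \<Longrightarrow> (\<forall>x. x \<notin> carrier G \<longrightarrow> g x = f x) \<Longrightarrow>
                penalized f\<^sub>0 \<kappa> f \<le> penalized f\<^sub>0 \<kappa> g"
    and x: "x \<in> carrier G"
  shows "p_laplacian p G K m f x =
     of_real (\<kappa> * p / 2 * energy f powr (1 - 1 / p)) * duality_map p (f x - f\<^sub>0 x)"
proof -
  define A where "A = energy f powr (1 / p - 1)"
  \<comment> \<open>The direction of the perturbation is the defect of the desired equation itself,
    so stationarity reads $|w|^2 = 0$.\<close>
  define w where "w = of_real (\<kappa> * p) * duality_map p (f x - f\<^sub>0 x) - of_real (2 * A) * p_laplacian p G K m f x"
  define v where "v = (\<lambda>y. if y = x then w else 0)"
  let ?g = "\<lambda>t::real. \<lambda>y. f y + of_real t * v y"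
  have E: "((\<lambda>t. energy (?g t)) has_real_derivative - 2 * p * Re (p_laplacian p G K m f x * cnj w)) (at 0)"
    unfolding v_def by (rule DERIV_energy_single[OF f x])
  have "((\<lambda>t. energy (?g t) powr (1 / p)) has_real_derivative
      energy (?g 0) powr (1 / p) * (0 * ln (energy (?g 0)) +
        - 2 * p * Re (p_laplacian p G K m f x * cnj w) * (1 / p) / energy (?g 0))) (at 0)"
    by (rule DERIV_powr[OF E]) (auto simp: pos)
  moreover have "energy f powr (1 / p) / energy f = A"
    using pos by (simp add: A_def powr_diff)
  moreover have "e * (0 * l + - 2 * p * R * (1 / p) / E) = - 2 * (e / E) * R" for e l R E :: real
    using p_gt_1 by simp
  ultimately have N: "((\<lambda>t. energy (?g t) powr (1 / p)) has_real_derivative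
      - 2 * A * Re (p_laplacian p G K m f x * cnj w)) (at 0)"
    by (simp only: of_real_0 mult_zero_left add_0_right)
  have "((\<lambda>t::real. \<Sum>\<^sub>\<infinity>y\<in>carrier G. cmod ((f y - f\<^sub>0 y) + of_real t * v y) powr p) has_real_derivative
      p * (\<Sum>y\<in>{x}. Re (duality_map p (f y - f\<^sub>0 y) * cnj (v y)))) (at 0)"
    using x by (intro DERIV_infsum_cmod_powr p_gt_1 diff_summable f f\<^sub>0) (auto simp: v_def)
  then have B: "((\<lambda>t::real. \<Sum>\<^sub>\<infinity>y\<in>carrier G. cmod (?g t y - f\<^sub>0 y) powr p) has_real_derivative
      p * Re (duality_map p (f x - f\<^sub>0 x) * cnj w)) (at 0)"
    by (simp add: v_def algebra_simps)
  have "((\<lambda>t. penalized f\<^sub>0 \<kappa> (?g t)) has_real_derivative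
      - 2 * A * Re (p_laplacian p G K m f x * cnj w) +
      \<kappa> * (p * Re (duality_map p (f x - f\<^sub>0 x) * cnj w))) (at 0)"
    unfolding penalized_def by (intro DERIV_add DERIV_cmult N B)
  moreover have "penalized f\<^sub>0 \<kappa> (?g 0) \<le> penalized f\<^sub>0 \<kappa> (?g t)" for t
  proof -
    have "(\<lambda>y. cmod (v y) powr p) summable_on carrier G"
      by (rule summable_on_cong_neutral[THEN iffD1, OF _ _ _ summable_on_finite[of "{x}"]])
        (auto simp: v_def x)
    then have "?g t \<in> ell p G"
      using p_gt_1 f by (intro ell_add ell_cmult) (auto simp: ell_def)
    moreover have "\<forall>y. y \<notin> carrier G \<longrightarrow> ?g t y = f y" using x by (auto simp: v_def)
    ultimately show ?thesis using min by simp
  qed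
  ultimately have "- 2 * A * Re (p_laplacian p G K m f x * cnj w) +
      \<kappa> * (p * Re (duality_map p (f x - f\<^sub>0 x) * cnj w)) = 0"
    by (intro DERIV_local_min[of _ _ 0 1]) auto
  then have "Re (w * cnj w) = 0"
    by (subst (1) w_def) (simp add: algebra_simps)
  then have "w = 0" by (simp add: complex_norm_square[symmetric])
  \<comment> \<open>This exhibits the reciprocal of \<open>2 * A\<close>, used to solve
    \<open>w = 0\<close> for the p-Laplacian.\<close>
  have "energy f powr (1 - 1 / p) / 2 * (2 * A) = 1"
    using pos by (simp add: A_def powr_add[symmetric])
  then have "p_laplacian p G K m f x =
      of_real (energy f powr (1 - 1 / p) / 2 * (2 * A)) * p_laplacian p G K m f x"
    by (simp only: of_real_1 mult_1_left)
  then have "p_laplacian p G K m f x =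
      of_real (energy f powr (1 - 1 / p) / 2) * (of_real (2 * A) * p_laplacian p G K m f x)"
    by (simp only: of_real_mult mult.assoc)
  also have "of_real (2 * A) * p_laplacian p G K m f x = of_real (\<kappa> * p) * duality_map p (f x - f\<^sub>0 x)"
    using \<open>w = 0\<close> by (simp add: w_def)
  finally show ?thesis by (simp add: mult_ac)
qed

subsection \<open>The two implications\<close>

lemma p_laplacian_bound_imp_poincare:
  assumes G: "infinite (carrier G)" "generate G K = carrier G" and "0 < C"
    and bound: "\<And>f. f \<in> ell p G \<Longrightarrow>
      C * dirichlet_norm p G K m f powr (p - 1) \<le> ell_norm q G (p_laplacian p G K m f)"
    and f\<^sub>0: "f\<^sub>0 \<in> ell p G"
  shows "C / (4 * p) * ell_norm p G f\<^sub>0 \<le> dirichlet_norm p G K m f\<^sub>0"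
proof (rule ccontr)
  define b where "b = ell_norm p G f\<^sub>0"
  define a where "a = C / (4 * p) * b"
  define \<kappa> where "\<kappa> = 4 powr p * a / b powr p"
  assume "\<not> ?thesis"
  then have N0: "energy f\<^sub>0 powr (1 / p) < a" by (simp add: dirichlet_norm_eq a_def b_def)
  \<comment> \<open>The strict bound by a forces a > 0 and hence b > 0, which disposes of vanishing
    \<open>f\<^sub>0\<close>.\<close>
  have "0 \<le> energy f\<^sub>0 powr (1 / p)" by simp
  with N0 have a: "0 < a" by linarith
  then have b: "0 < b" using \<open>0 < C\<close> p_gt_1 by (simp add: a_def zero_less_divide_iff zero_less_mult_iff)
  have \<kappa>: "0 < \<kappa>" using a b by (simp add: \<kappa>_def)
  obtain f where f: "f \<in> ell p G" "\<And>x. x \<notin> carrier G \<Longrightarrow> f x = f\<^sub>0 x"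
    and min: "\<And>g. g \<in> ell p G \<Longrightarrow> (\<forall>x. x \<notin> carrier G \<longrightarrow> g x = f\<^sub>0 x) \<Longrightarrow>
                penalized f\<^sub>0 \<kappa> f \<le> penalized f\<^sub>0 \<kappa> g"
    using penalized_attains_minimum[OF f\<^sub>0 \<kappa>] by auto
  define B where "B = (\<Sum>\<^sub>\<infinity>x\<in>carrier G. cmod (f x - f\<^sub>0 x) powr p)"
  have "penalized f\<^sub>0 \<kappa> f \<le> energy f\<^sub>0 powr (1 / p)"
    using min[OF f\<^sub>0] p_gt_1 by (simp add: penalized_def)
  then have "energy f powr (1 / p) + \<kappa> * B < a"
    using N0 by (simp add: penalized_def B_def)
  then have "\<kappa> * B < a" by (smt (verit) powr_ge_zero)
  then have "B < a / \<kappa>" using \<kappa> by (simp add: field_simps)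
  also have "a / \<kappa> = (b / 4) powr p" using a b by (simp add: \<kappa>_def powr_divide)
  finally have B: "B < (b / 4) powr p" .
  have B0: "0 \<le> B" by (simp add: B_def infsum_nonneg)
  \<comment> \<open>A vanishing f would be at distance b from \<open>f\<^sub>0\<close>, beyond b/4.
    Nonvanishing gives the positive energy required by \<open>euler_lagrange\<close>.\<close>
  have "\<exists>x\<in>carrier G. f x \<noteq> 0"
  proof (rule ccontr)
    assume "\<not> ?thesis"
    then have "B = b powr p"
      using p_gt_1 by (simp add: B_def b_def ell_norm_powr cong: infsum_cong)
    moreover have "(b / 4) powr p \<le> b powr p" using b p_gt_1 by (intro powr_mono2) auto
    ultimately show False using B by simp
  qed
  then have pos: "0 < energy f" using energy_pos[OF G f(1)] by blast
  define M where "M = energy f powr (1 - 1 / p)"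
  have M: "0 < M" using pos by (simp add: M_def)
  have EL: "p_laplacian p G K m f x = of_real (\<kappa> * p / 2 * M) * duality_map p (f x - f\<^sub>0 x)"
    if "x \<in> carrier G" for x
    unfolding M_def using f min by (intro euler_lagrange[OF f\<^sub>0 \<kappa> f(1) pos _ that]) auto
  have c: "0 \<le> \<kappa> * p / 2 * M" using \<kappa> p_gt_1 M by simp
  \<comment> \<open>The q-th power of the modulus of the duality map is again a p-th power, so the
    q-norm of the p-Laplacian is an exact multiple of $B^{1/q}$.\<close>
  have "(\<Sum>\<^sub>\<infinity>x\<in>carrier G. cmod (p_laplacian p G K m f x) powr q) =
      (\<Sum>\<^sub>\<infinity>x\<in>carrier G. (\<kappa> * p / 2 * M) powr q * cmod (f x - f\<^sub>0 x) powr p)"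
    by (intro infsum_cong)
      (simp only: EL norm_mult norm_of_real abs_of_nonneg[OF c] powr_mult norm_ge_zero c
        norm_duality_map_powr[OF p_gt_1 q_eq])
  also have "\<dots> = (\<kappa> * p / 2 * M) powr q * B"
    unfolding B_def by (rule infsum_cmult_right) (rule diff_summable[OF f(1) f\<^sub>0])
  finally have "ell_norm q G (p_laplacian p G K m f) = ((\<kappa> * p / 2 * M) powr q * B) powr (1 / q)"
    by (simp add: ell_norm_def)
  also have "\<dots> = \<kappa> * p / 2 * M * B powr (1 / q)"
    using c q_gt_1 by (simp add: powr_mult powr_powr)
  also have "\<dots> \<le> \<kappa> * p / 2 * M * ((b / 4) powr p) powr (1 / q)"
    using B B0 c q_gt_1 by (intro mult_left_mono powr_mono2) auto
  also have "((b / 4) powr p) powr (1 / q) = (b / 4) powr (p - 1)"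
    using p_gt_1 by (simp add: powr_powr q_eq)
  finally have "ell_norm q G (p_laplacian p G K m f) \<le> \<kappa> * p / 2 * M * (b / 4) powr (p - 1)" .
  moreover have "dirichlet_norm p G K m f powr (p - 1) = M"
    using p_gt_1 by (simp add: dirichlet_norm_eq powr_powr M_def diff_divide_distrib)
  ultimately have "C * M \<le> \<kappa> * p / 2 * M * (b / 4) powr (p - 1)"
    using bound[OF f(1)] by simp
  then have "C \<le> \<kappa> * p / 2 * (b / 4) powr (p - 1)"
    using M by (simp add: mult.assoc mult.left_commute[of M])
  also have "\<dots> = 2 * p * (a / b)"
    using b by (simp add: \<kappa>_def powr_diff powr_divide)
  also have "\<dots> = C / 2" using b p_gt_1 by (simp add: a_def)
  finally show False using \<open>0 < C\<close> by simp
qed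

text \<open>Young's inequality is applied to |f|/s and s times the modulus of the p-Laplacian, and
  the term in f is absorbed through the assumed inequality. The constant is what remains after
  taking q-th roots, with $D^{p/q} = D^{p-1}$ for the Dirichlet norm D.\<close>

lemma poincare_imp_p_laplacian_bound:
  assumes "0 < c" "f \<in> ell p G" and poincare: "c * ell_norm p G f \<le> dirichlet_norm p G K m f"
  shows "(q / (4 * (4 / (p * c powr p)) powr (q / p))) powr (1 / q) *
      dirichlet_norm p G K m f powr (p - 1) \<le> ell_norm q G (p_laplacian p G K m f)"
proof -
  define L where "L = p_laplacian p G K m f"
  \<comment> \<open>This s solves $1/(p s^p) = c^p/4$. After doubling, the term in f is then at most
    half the energy.\<close>
  define s where "s = (4 / (p * c powr p)) powr (1 / p)"
  define X where "X = (\<Sum>\<^sub>\<infinity>x\<in>carrier G. cmod (L x) powr q)"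
  define Y where "Y = (\<Sum>\<^sub>\<infinity>x\<in>carrier G. cmod (f x) powr p)"
  have p: "0 < p" "1 < p" and q: "0 < q" using p_gt_1 q_gt_1 by auto
  have s: "0 < s" using \<open>0 < c\<close> p by (simp add: s_def)
  have L: "L \<in> ell q G" unfolding L_def by (rule p_laplacian_ell[OF assms(2)])
  have "(c * ell_norm p G f) powr p \<le> dirichlet_norm p G K m f powr p"
    using \<open>0 < c\<close> p poincare by (intro powr_mono2) (auto simp: ell_norm_def)
  then have Y: "c powr p * Y \<le> energy f"
    using \<open>0 < c\<close> p energy_nonneg[of f]
    by (simp add: powr_mult ell_norm_powr Y_def dirichlet_norm_eq powr_powr)
  have "(\<Sum>\<^sub>\<infinity>x\<in>carrier G. cmod (f x) * cmod (L x)) \<le>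
      (\<Sum>\<^sub>\<infinity>x\<in>carrier G. (1 / (s powr p * p)) * cmod (f x) powr p + (s powr q / q) * cmod (L x) powr q)"
  proof (rule infsum_mono)
    show "(\<lambda>x. cmod (f x) * cmod (L x)) summable_on carrier G"
      by (rule ell_mult_abs_summable[OF p_gt_1 q_gt_1 conjugate assms(2) L])
    show "(\<lambda>x. (1 / (s powr p * p)) * cmod (f x) powr p + (s powr q / q) * cmod (L x) powr q) summable_on carrier G"
      using assms(2) L unfolding ell_def mem_Collect_eq
      by (intro summable_on_add summable_on_cmult_right)
    show "cmod (f x) * cmod (L x) \<le>
        (1 / (s powr p * p)) * cmod (f x) powr p + (s powr q / q) * cmod (L x) powr q" for x
      using Youngs_inequality[OF p_gt_1 q_gt_1 conjugate, of "cmod (f x) / s" "s * cmod (L x)"] s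
      by (simp add: powr_divide powr_mult)
  qed
  also have "\<dots> = (1 / (s powr p * p)) * Y + (s powr q / q) * X"
    unfolding X_def Y_def using assms(2) L unfolding ell_def mem_Collect_eq
    by (subst infsum_add) (auto intro!: summable_on_cmult_right simp: infsum_cmult_right simp del: times_divide_eq_left)
  also have "(1 / (s powr p * p)) * Y = c powr p * Y / 4"
    using \<open>0 < c\<close> p by (simp add: s_def powr_powr)
  finally have "energy f \<le> 2 * (c powr p * Y / 4 + (s powr q / q) * X)"
    using energy_le_infsum_p_laplacian[OF assms(2)] unfolding L_def distrib_left by linarith
  with Y have "energy f \<le> 4 * ((s powr q / q) * X)" unfolding distrib_left by linarith
  then have "q / (4 * s powr q) * energy f \<le> X" using s q by (simp add: field_simps)
  then have "(q / (4 * s powr q) * energy f) powr (1 / q) \<le> X powr (1 / q)"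
    using q s energy_nonneg[of f] by (intro powr_mono2) auto
  moreover have "energy f powr (1 / q) = dirichlet_norm p G K m f powr (p - 1)"
    using p by (simp add: dirichlet_norm_eq powr_powr q_eq)
  moreover have "s powr q = (4 / (p * c powr p)) powr (q / p)"
    using p by (simp add: s_def powr_powr)
  moreover have "(q / (4 * s powr q) * energy f) powr (1 / q) =
      (q / (4 * s powr q)) powr (1 / q) * energy f powr (1 / q)"
    using q s energy_nonneg[of f] by (simp add: powr_mult del: times_divide_eq_left)
  ultimately show ?thesis unfolding ell_norm_def X_def L_def by (simp only:)
qed

section \<open>Comparing the Dirichlet norm with the maximal displacement\<close>

text \<open>Only the summand of a maximising generator is kept, and its weight is at least
  \<open>\<mu>\<close>.\<close>

lemma Max_grad_le_dirichlet_norm: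
  assumes "0 < \<mu>" "\<And>\<gamma>. \<gamma> \<in> K \<Longrightarrow> \<mu> \<le> m \<gamma>"
  shows "\<mu> powr (1 / p) * Max ((\<lambda>\<gamma>. ell_norm p G (grad G f \<gamma>)) ` K) \<le> dirichlet_norm p G K m f"
proof -
  have "K \<noteq> {}" using sum_weight by auto
  then have "Max ((\<lambda>\<gamma>. ell_norm p G (grad G f \<gamma>)) ` K) \<in> (\<lambda>\<gamma>. ell_norm p G (grad G f \<gamma>)) ` K"
    using finite_K by (intro Max_in) auto
  then obtain \<gamma> where Max: "Max ((\<lambda>\<gamma>. ell_norm p G (grad G f \<gamma>)) ` K) = ell_norm p G (grad G f \<gamma>)"
    and \<gamma>: "\<gamma> \<in> K"
    by (rule imageE)
  have "\<mu> * ell_norm p G (grad G f \<gamma>) powr p \<le> m \<gamma> * ell_norm p G (grad G f \<gamma>) powr p"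
    using assms(2)[OF \<gamma>] by (intro mult_right_mono) auto
  also have "\<dots> \<le> (\<Sum>\<gamma>\<in>K. m \<gamma> * ell_norm p G (grad G f \<gamma>) powr p)"
    using \<gamma> finite_K by (intro member_le_sum mult_nonneg_nonneg) (auto intro: less_imp_le weight_pos)
  finally have "(\<mu> * ell_norm p G (grad G f \<gamma>) powr p) powr (1 / p) \<le> dirichlet_norm p G K m f"
    using assms(1) p_gt_1 unfolding dirichlet_norm_def
    by (intro powr_mono2) (auto simp: mult.commute)
  then show ?thesis
    using assms(1) p_gt_1 by (simp add: Max powr_mult powr_powr ell_norm_nonneg)
qed

text \<open>The weights sum to 1, so the Dirichlet norm is a power mean of the
  displacements.\<close>

lemma dirichlet_norm_le_Max_grad:
  "dirichlet_norm p G K m f \<le> Max ((\<lambda>\<gamma>. ell_norm p G (grad G f \<gamma>)) ` K)" (is "_ \<le> ?M")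
proof -
  have "K \<noteq> {}" using sum_weight by auto
  then obtain \<gamma> where "\<gamma> \<in> K" by auto
  have le: "ell_norm p G (grad G f \<gamma>) \<le> ?M" if "\<gamma> \<in> K" for \<gamma>
    using that finite_K by simp
  have M: "0 \<le> ?M" using le[OF \<open>\<gamma> \<in> K\<close>] by (smt (verit) ell_norm_def powr_ge_zero)
  have "(\<Sum>\<gamma>\<in>K. ell_norm p G (grad G f \<gamma>) powr p * m \<gamma>) \<le> (\<Sum>\<gamma>\<in>K. ?M powr p * m \<gamma>)"
    using p_gt_1 le
    by (intro sum_mono mult_right_mono powr_mono2) (auto simp: ell_norm_def intro: less_imp_le weight_pos)
  also have "\<dots> = ?M powr p" by (simp add: sum_weight flip: sum_distrib_left)
  finally have "dirichlet_norm p G K m f \<le> (?M powr p) powr (1 / p)"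
    unfolding dirichlet_norm_def using p_gt_1
    by (intro powr_mono2) (auto intro!: sum_nonneg mult_nonneg_nonneg intro: less_imp_le weight_pos)
  then show ?thesis using M p_gt_1 by (simp add: powr_powr)
qed

end

theorem corollary1p3:
  fixes G :: "('a, 'b) monoid_scheme" and K :: "'a set" and m :: "'a \<Rightarrow> real" and p q :: real
  assumes "group G" and "infinite (carrier G)"
    and "K \<subseteq> carrier G" and "finite K" and "symmetric_set G K" and "generate G K = carrier G"
    and "symmetric_weight G K m"
    and "1 < p" and "q = p / (p - 1)"
  shows "(\<exists>C'>0. \<forall>f\<in>ell p G.
            Max ((\<lambda>\<gamma>. ell_norm p G (left_regular G \<gamma> f - f)) ` K) \<ge> C' * ell_norm p G f)
     \<longleftrightarrow> (\<exists>C>0. \<forall>f\<in>ell p G.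
            ell_norm q G (p_laplacian p G K m f) \<ge> C * dirichlet_norm p G K m f powr (p - 1))"
    (is "?i \<longleftrightarrow> ?ii")
proof
  interpret weighted_group G K m p q
    using assms by (simp add: weighted_group_def weighted_group_axioms_def)
  {
    assume ?i
    then obtain C' where "0 < C'" and C': "\<And>f. f \<in> ell p G \<Longrightarrow>
        C' * ell_norm p G f \<le> Max ((\<lambda>\<gamma>. ell_norm p G (grad G f \<gamma>)) ` K)"
      by (auto simp: grad_def)
    have "K \<noteq> {}" using sum_weight by auto
    \<comment> \<open>The least weight over the finite set K is positive and serves as the uniform
      lower bound in the comparison with the maximum.\<close>
    then obtain \<gamma> where \<gamma>: "\<gamma> \<in> K" "\<And>\<delta>. \<delta> \<in> K \<Longrightarrow> m \<gamma> \<le> m \<delta>"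
      using ex_is_arg_min_if_finite[OF finite_K, of m] by (auto simp: is_arg_min_linorder)
    define c where "c = m \<gamma> powr (1 / p) * C'"
    have "0 < c" using weight_pos[OF \<gamma>(1)] \<open>0 < C'\<close> by (simp add: c_def)
    have "c * ell_norm p G f \<le> dirichlet_norm p G K m f" if "f \<in> ell p G" for f
    proof -
      have "c * ell_norm p G f \<le> m \<gamma> powr (1 / p) * Max ((\<lambda>\<gamma>. ell_norm p G (grad G f \<gamma>)) ` K)"
        unfolding c_def mult.assoc by (intro mult_left_mono C' that) simp
      also have "\<dots> \<le> dirichlet_norm p G K m f"
        by (rule Max_grad_le_dirichlet_norm[OF weight_pos[OF \<gamma>(1)] \<gamma>(2)])
      finally show ?thesis .
    qed
    note bound = poincare_imp_p_laplacian_bound[OF \<open>0 < c\<close> _ this]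
    show ?ii
    proof (intro exI conjI ballI)
      show "0 < (q / (4 * (4 / (p * c powr p)) powr (q / p))) powr (1 / q)"
        using q_gt_1 \<open>0 < c\<close> p_gt_1 by simp
    qed (rule bound)
  next
    assume ?ii
    then obtain C where "0 < C" and C: "\<And>f. f \<in> ell p G \<Longrightarrow>
        C * dirichlet_norm p G K m f powr (p - 1) \<le> ell_norm q G (p_laplacian p G K m f)"
      by auto
    have "C / (4 * p) * ell_norm p G f \<le> Max ((\<lambda>\<gamma>. ell_norm p G (grad G f \<gamma>)) ` K)"
      if "f \<in> ell p G" for f
      using p_laplacian_bound_imp_poincare[OF assms(2,6) \<open>0 < C\<close> C that]
        dirichlet_norm_le_Max_grad[of f] by linarith
    then show ?i
      using \<open>0 < C\<close> p_gt_1 by (intro exI[of _ "C / (4 * p)"]) (auto simp: grad_def)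
  }
qed

end
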